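(* Let $p=p(n)\in(0,1)$ satisfy $p\gg\log(n)^2/n$, and let $G\sim\mathbb{D}(n,p)$ be an Erdős–Rényi directed random graph. Suppose there exists $\bar\alpha\in(0,1)$ such that for all $n\in\mathbb{N}$ and every $i\in[n]$ we have $\alpha_i\le\bar\alpha$. Let $x(G,\infty)$ be the stable opinion vector of the directed opinion dynamics on $G$ and $\bar x(\infty)$ the stable solution of the corresponding mean-field dynamics. Then, for any $\rho\in(1,\infty)$, $$\lim_{n\to\infty}\left\|\mathbf{E}(x(G,\infty))-\bar x(\infty)\right\|_{\rho}=0.$$
   Context: Notation: $[n]=\{1,\dots,n\}$; $\log$ is the natural logarithm; for $h:\mathbb{N}\to\mathbb{R}_+$, $p\gg h$ means $p(n)/h(n)\to\infty$ as $n\to\infty$; $\|v\|_\rho=(\sum_{i=1}^n|v_i|^\rho)^{1/\rho}$ for $v\in\mathbb{R}^n$. $\mathbb{D}(n,p)$ is the random simple directed graph (no loops) on node set $[n]$ in which each ordered pair $(i,j)$, $i\ne j$, is an edge independently with probability $p=p(n)$. For a directed graph $G$, $N^+(i)=\{j\in[n]:(i,j)\in E(G)\}$ and $\deg^+(i)=|N^+(i)|$. For each $n$ there are given deterministic initial opinions $x(0)\in[0,1]^n$ and values $\alpha_i\in[0,1]$, $i\in[n]$ (these data may depend on $n$; $\bar\alpha$ does not). Directed opinion dynamics: $x(G,0)=x(0)$ and, for $t\ge0$, $$x_i(G,t+1)=\begin{cases}\frac{\alpha_i}{\deg^+(i)}\sum_{j\in N^+(i)}x_j(G,t)+(1-\alpha_i)x_i(0)&\text{if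 }\deg^+(i)>0,\\ \alpha_ix_i(G,t)+(1-\alpha_i)x_i(0)&\text{if }\deg^+(i)=0.\end{cases}$$ Equivalently $x(G,t+1)=H(G)x(G,t)+Bx(0)$, where $B=\mathrm{diag}(1-\alpha_1,\dots,1-\alpha_n)$ and $H_{ij}(G)=\alpha_iA_{ij}(G)/\deg^+(i)$ if $\deg^+(i)>0$, $H_{ij}(G)=\alpha_i1_{\{i=j\}}$ if $\deg^+(i)=0$, with $A(G)$ the (asymmetric) adjacency matrix ($A_{ij}(G)=1$ iff $(i,j)\in E(G)$). The stable opinion vector is $x(G,\infty)=\lim_{t\to\infty}x(G,t)$, which exists when all $\alpha_i\le\bar\alpha<1$ and equals $(I-H(G))^{-1}Bx(0)$. Mean-field dynamics: $\bar x(0)=x(0)$ and $\bar x(t+1)=\mathbf{E}(H(G))^tx(0)+\sum_{k=0}^{t-1}\mathbf{E}(H(G))^kBx(0)$, with $\mathbf{E}(H(G))$ the entrywise expectation for $G\sim\mathbb{D}(n,p)$; its stable solution is $\bar x(\infty)=\lim_{t\to\infty}\bar x(t)$, which exists when all $\alpha_i\le\bar\alpha<1$ and equals $(I-\mathbf{E}(H(G)))^{-1}Bx(0)$. *)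

theory Defs
  imports "HOL-Probability.Probability" "Jordan_Normal_Form.Matrix"
begin

unbundle no vec_syntax
hide_const (open) Finite_Cartesian_Product.vec Finite_Cartesian_Product.mat
hide_type (open) Finite_Cartesian_Product.vec

text \<open>
  A directed graph with \<open>n\<close> nodes is given by its edge set, a relation on \<open>{0..<n}\<close>.
  The nodes are numbered from \<open>0\<close> instead of \<open>1\<close>, in agreement with the indexing of
  \<^typ>\<open>real vec\<close> and \<^typ>\<open>real mat\<close>.
\<close>

type_synonym digraph = "nat rel"

definition possible_edges :: "nat \<Rightarrow> digraph" where
  "possible_edges n = {(i, j). i < n \<and> j < n \<and> i \<noteq> j}"

definition random_digraph :: "nat \<Rightarrow> real \<Rightarrow> digraph pmf" where
  "random_digraph n p =
     map_pmf (\<lambda>f. {e \<in> possible_edges n. f e})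
       (Pi_pmf (possible_edges n) False (\<lambda>_. bernoulli_pmf p))"

definition out_nbrs :: "digraph \<Rightarrow> nat \<Rightarrow> nat set" where
  "out_nbrs G i = {j. (i, j) \<in> G}"

definition out_deg :: "digraph \<Rightarrow> nat \<Rightarrow> nat" where
  "out_deg G i = card (out_nbrs G i)"

primrec opinion ::
  "nat \<Rightarrow> (nat \<Rightarrow> real) \<Rightarrow> real vec \<Rightarrow> digraph \<Rightarrow> nat \<Rightarrow> real vec" where
  "opinion n \<alpha> x0 G 0 = x0"
| "opinion n \<alpha> x0 G (Suc t) = vec n (\<lambda>i.
     if out_deg G i > 0
     then \<alpha> i / real (out_deg G i) * (\<Sum>j\<in>out_nbrs G i. opinion n \<alpha> x0 G t $ j)
            + (1 - \<alpha> i) * x0 $ i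
     else \<alpha> i * opinion n \<alpha> x0 G t $ i + (1 - \<alpha> i) * x0 $ i)"

definition stable_opinion ::
  "nat \<Rightarrow> (nat \<Rightarrow> real) \<Rightarrow> real vec \<Rightarrow> digraph \<Rightarrow> real vec" where
  "stable_opinion n \<alpha> x0 G = vec n (\<lambda>i. lim (\<lambda>t. opinion n \<alpha> x0 G t $ i))"

definition expected_stable_opinion ::
  "nat \<Rightarrow> real \<Rightarrow> (nat \<Rightarrow> real) \<Rightarrow> real vec \<Rightarrow> real vec" where
  "expected_stable_opinion n p \<alpha> x0 =
     vec n (\<lambda>i. measure_pmf.expectation (random_digraph n p)
                  (\<lambda>G. stable_opinion n \<alpha> x0 G $ i))"

definition H_mat :: "nat \<Rightarrow> (nat \<Rightarrow> real) \<Rightarrow> digraph \<Rightarrow> real mat" where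
  "H_mat n \<alpha> G = mat n n (\<lambda>(i, j).
     if out_deg G i > 0
     then \<alpha> i * of_bool ((i, j) \<in> G) / real (out_deg G i)
     else \<alpha> i * of_bool (i = j))"

definition B_mat :: "nat \<Rightarrow> (nat \<Rightarrow> real) \<Rightarrow> real mat" where
  "B_mat n \<alpha> = mat_diag n (\<lambda>i. 1 - \<alpha> i)"

definition expected_H :: "nat \<Rightarrow> real \<Rightarrow> (nat \<Rightarrow> real) \<Rightarrow> real mat" where
  "expected_H n p \<alpha> = mat n n (\<lambda>(i, j).
     measure_pmf.expectation (random_digraph n p) (\<lambda>G. H_mat n \<alpha> G $$ (i, j)))"

text \<open>The sum of vectors is written componentwise, as \<^typ>\<open>real vec\<close> is not a monoid.\<close>

primrec mean_field ::
  "nat \<Rightarrow> real \<Rightarrow> (nat \<Rightarrow> real) \<Rightarrow> real vec \<Rightarrow> nat \<Rightarrow> real vec" where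
  "mean_field n p \<alpha> x0 0 = x0"
| "mean_field n p \<alpha> x0 (Suc t) =
     (expected_H n p \<alpha> ^\<^sub>m t) *\<^sub>v x0 +
     vec n (\<lambda>i. \<Sum>k<t. ((expected_H n p \<alpha> ^\<^sub>m k) *\<^sub>v (B_mat n \<alpha> *\<^sub>v x0)) $ i)"

definition mean_field_stable ::
  "nat \<Rightarrow> real \<Rightarrow> (nat \<Rightarrow> real) \<Rightarrow> real vec \<Rightarrow> real vec" where
  "mean_field_stable n p \<alpha> x0 = vec n (\<lambda>i. lim (\<lambda>t. mean_field n p \<alpha> x0 t $ i))"

definition lp_norm :: "real \<Rightarrow> real vec \<Rightarrow> real" where
  "lp_norm \<rho> v = (\<Sum>i<dim_vec v. \<bar>v $ i\<bar> powr \<rho>) powr (1 / \<rho>)"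

definition asymp_dominates :: "(nat \<Rightarrow> real) \<Rightarrow> (nat \<Rightarrow> real) \<Rightarrow> bool"  (infix "\<ggreater>" 50) where
  "p \<ggreater> h \<longleftrightarrow> filterlim (\<lambda>n. p n / h n) at_top sequentially"

end

theory Submission
  imports Defs
begin

text \<open>
  The rows of \<open>H(G)\<close> are independent, so \<open>E x(G,\<infinity>)\<close> would satisfy the mean-field equation
  exactly if the opinions \<open>x\<^sub>j(G,\<infinity>)\<close> did not depend on the out-edges of \<open>i\<close>.  Deleting these
  out-edges changes \<open>x\<^sub>j\<close> by at most the probability \<open>h\<^sub>j\<close> that a random walk killed at rate
  \<open>1 - a\<close> gets from \<open>j\<close> to \<open>i\<close>.  The walk from \<open>j\<close> visits a bounded expected number of
  nodes, and by exchangeability all targets \<open>i \<noteq> j\<close> are equally likely, so \<open>E h\<^sub>j = O(1/n)\<close>.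
  Together with the negligible probability \<open>(1 - p)\<^sup>n\<^sup>-\<^sup>1\<close> of out-degree zero this gives an entrywise
  bias \<open>O(1/n)\<close>, whose \<open>\<rho>\<close>-norm is \<open>O(n\<^bsup>1/\<rho> - 1\<^esup>)\<close>.
\<close>

subsection \<open>Averaging over out-neighbours\<close>

text \<open>At an index where \<open>u\<close> attains its maximum \<open>m\<close>, a positive
  \<open>m\<close> would satisfy \<open>m \<le> a * m\<close> with \<open>a < 1\<close>. This
  replaces inverting I - H(G): all comparisons of fixed points below, random or mean-field, reduce
  to it.\<close>

lemma maximum_principle:
  fixes u :: "nat \<Rightarrow> real"
  assumes "a < 1"
    and step: "\<And>i m. i < n \<Longrightarrow> 0 \<le> m \<Longrightarrow> (\<And>j. j < n \<Longrightarrow> u j \<le> m) \<Longrightarrow> u i \<le> a * m"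
    and "i < n"
  shows "u i \<le> 0"
proof (rule ccontr)
  assume "\<not> u i \<le> 0"
  define m where "m = Max (u ` {..<n})"
  have le: "u j \<le> m" if "j < n" for j
    using that by (auto simp: m_def)
  have "m \<in> u ` {..<n}"
    unfolding m_def using \<open>i < n\<close> by (intro Max_in) auto
  then obtain k where k: "k < n" "u k = m" by auto
  have "0 < m" using le[OF \<open>i < n\<close>] \<open>\<not> u i \<le> 0\<close> by simp
  with step[OF k(1), of m] le k have "m \<le> a * m" by simp
  with \<open>0 < m\<close> \<open>a < 1\<close> show False by simp
qed

text \<open>The transition kernel P of the random walk on \<open>G\<close>. A node without out-edges
  holds the walk, so every row of P is a probability vector and H(G) = diag(\<alpha>) P without case
  distinction.\<close>

definition nbr_avg :: "digraph \<Rightarrow> (nat \<Rightarrow> real) \<Rightarrow> nat \<Rightarrow> real" where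
  "nbr_avg G f i =
     (if out_deg G i > 0 then (\<Sum>j\<in>out_nbrs G i. f j) / real (out_deg G i) else f i)"

lemma out_nbrs_subset: "G \<subseteq> possible_edges n \<Longrightarrow> out_nbrs G i \<subseteq> {..<n}"
  by (auto simp: out_nbrs_def possible_edges_def)

lemma nbr_avg_mono:
  assumes "G \<subseteq> possible_edges n" "i < n" "\<And>j. j < n \<Longrightarrow> f j \<le> g j"
  shows "nbr_avg G f i \<le> nbr_avg G g i"
  unfolding nbr_avg_def using assms(2,3) out_nbrs_subset[OF assms(1), of i]
  by (auto intro!: divide_right_mono sum_mono)

lemma nbr_avg_const [simp]: "nbr_avg G (\<lambda>_. c) i = c"
  by (simp add: nbr_avg_def out_deg_def)

lemma nbr_avg_diff: "nbr_avg G (\<lambda>j. f j - g j) i = nbr_avg G f i - nbr_avg G g i"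
  by (simp add: nbr_avg_def sum_subtractf diff_divide_distrib)

lemma nbr_avg_cmult: "nbr_avg G (\<lambda>j. c * f j) i = c * nbr_avg G f i"
  by (simp add: nbr_avg_def sum_distrib_left)

lemma nbr_avg_uminus: "nbr_avg G (\<lambda>j. - f j) i = - nbr_avg G f i"
  using nbr_avg_cmult[of G "-1" f i] by simp

lemma nbr_avg_sum: "nbr_avg G (\<lambda>j. \<Sum>k\<in>K. f k j) i = (\<Sum>k\<in>K. nbr_avg G (f k) i)"
  by (simp add: nbr_avg_def sum.swap[of _ K] flip: sum_divide_distrib)

lemma nbr_avg_le:
  assumes "G \<subseteq> possible_edges n" "i < n" "\<And>j. j < n \<Longrightarrow> f j \<le> c"
  shows "nbr_avg G f i \<le> c"
  using nbr_avg_mono[OF assms(1,2), of f "\<lambda>_. c"] assms(3) by simp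

lemma nbr_avg_ge:
  assumes "G \<subseteq> possible_edges n" "i < n" "\<And>j. j < n \<Longrightarrow> c \<le> f j"
  shows "c \<le> nbr_avg G f i"
  using nbr_avg_mono[OF assms(1,2), of "\<lambda>_. c" f] assms(3) by simp

lemma tendsto_nbr_avg:
  assumes "G \<subseteq> possible_edges n" "i < n" "\<And>j. j < n \<Longrightarrow> (\<lambda>t. f t j) \<longlonglongrightarrow> s j"
  shows "(\<lambda>t. nbr_avg G (f t) i) \<longlonglongrightarrow> nbr_avg G s i"
  unfolding nbr_avg_def using assms(2,3) out_nbrs_subset[OF assms(1), of i]
  by (auto intro!: tendsto_intros)

lemma nbr_avg_remove_row:
  assumes "j \<noteq> i"
  shows "nbr_avg (G - {i} \<times> UNIV) f j = nbr_avg G f j"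
proof -
  have "out_nbrs (G - {i} \<times> UNIV) j = out_nbrs G j"
    using assms by (auto simp: out_nbrs_def)
  then show ?thesis by (simp add: nbr_avg_def out_deg_def)
qed

text \<open>Cutting the out-edges of \<open>i\<close> makes \<open>i\<close> absorbing while all
  other rows of the kernel stay the same.\<close>

lemma nbr_avg_removed_row: "nbr_avg (G - {i} \<times> UNIV) f i = f i"
  by (simp add: nbr_avg_def out_deg_def out_nbrs_def)

lemma nbr_avg_image:
  assumes "inj \<pi>"
  shows "nbr_avg (map_prod \<pi> \<pi> ` G) f (\<pi> j) = nbr_avg G (f \<circ> \<pi>) j"
proof -
  have eq: "out_nbrs (map_prod \<pi> \<pi> ` G) (\<pi> j) = \<pi> ` out_nbrs G j"
    using assms by (force simp: out_nbrs_def inj_eq)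
  have inj: "inj_on \<pi> S" for S using assms by (rule inj_on_subset) simp
  show ?thesis
    by (simp add: nbr_avg_def out_deg_def eq card_image[OF inj] sum.reindex[OF inj])
qed

subsection \<open>The stable opinion as a fixed point\<close>

lemma opinion_Suc:
  assumes "i < n"
  shows "opinion n \<alpha> x0 G (Suc t) $ i =
    \<alpha> i * nbr_avg G (\<lambda>j. opinion n \<alpha> x0 G t $ j) i + (1 - \<alpha> i) * x0 $ i"
  using assms by (simp add: nbr_avg_def)

lemma convergent_of_geometric_increments:
  fixes f :: "nat \<Rightarrow> real"
  assumes "\<And>t. \<bar>f (Suc t) - f t\<bar> \<le> C * a ^ t" "0 \<le> a" "a < 1"
  shows "convergent f"
proof -
  have "summable (\<lambda>t. f (Suc t) - f t)"
    by (rule summable_comparison_test'[where g = "\<lambda>t. C * a ^ t" and N = 0])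
       (use assms in \<open>auto intro!: summable_mult summable_geometric\<close>)
  then have "convergent (\<lambda>m. \<Sum>t<m. f (Suc t) - f t)"
    by (simp add: summable_iff_convergent)
  then have "convergent (\<lambda>m. f m - f 0)"
    by (simp add: sum_lessThan_telescope)
  from convergent_add[OF this convergent_const[of "f 0"]] show ?thesis by simp
qed

text \<open>One fixed realisation of the graph. The uniform bound \<open>a < 1\<close> on the
  weights makes diag(\<alpha>) P a contraction in the sup norm.\<close>

locale averaging =
  fixes n :: nat and \<alpha> :: "nat \<Rightarrow> real" and a :: real and G :: digraph
  assumes edges: "G \<subseteq> possible_edges n"
    and weight: "\<And>i. i < n \<Longrightarrow> 0 \<le> \<alpha> i" "\<And>i. i < n \<Longrightarrow> \<alpha> i \<le> a"
    and a: "0 \<le> a" "a < 1"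
begin

text \<open>The contraction in the one-sided shape that \<open>maximum_principle\<close> asks for.
  The sign of \<open>m\<close> matters, since \<alpha> is replaced by the larger
  \<open>a\<close>.\<close>

lemma weighted_avg_le:
  assumes "i < n" "0 \<le> m" "\<And>j. j < n \<Longrightarrow> f j \<le> m"
  shows "\<alpha> i * nbr_avg G f i \<le> a * m"
proof -
  have "\<alpha> i * nbr_avg G f i \<le> \<alpha> i * m"
    using nbr_avg_le[OF edges assms(1,3)] weight(1) assms(1) by (intro mult_left_mono) auto
  also have "\<dots> \<le> a * m"
    using weight(2) assms by (intro mult_right_mono) auto
  finally show ?thesis .
qed

text \<open>The constant term cancels in the increments, which are therefore mapped by
  diag(\<alpha>) P in each step and decay like \<open>a ^ t\<close>.\<close>

lemma opinion_tendsto: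
  assumes "i < n"
  shows "(\<lambda>t. opinion n \<alpha> x0 G t $ i) \<longlonglongrightarrow> stable_opinion n \<alpha> x0 G $ i"
proof -
  define f where "f t j = opinion n \<alpha> x0 G t $ j" for t j
  \<comment> \<open>Any common bound on the first increments would do; a sum, unlike a maximum, also
    makes sense for an empty index set.\<close>
  define C where "C = (\<Sum>j<n. \<bar>f 1 j - f 0 j\<bar>)"
  have bound: "\<bar>f (Suc t) j - f t j\<bar> \<le> C * a ^ t" if "j < n" for t j
    using that
  proof (induction t arbitrary: j)
    case 0
    then show ?case unfolding C_def by (auto intro!: member_le_sum)
  next
    case (Suc t)
    have nn: "0 \<le> C * a ^ t" using a unfolding C_def by (auto intro!: mult_nonneg_nonneg sum_nonneg)
    have rec: "f (Suc t) j = \<alpha> j * nbr_avg G (f t) j + (1 - \<alpha> j) * x0 $ j" for t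
      unfolding f_def using Suc.prems by (rule opinion_Suc)
    have "f (Suc (Suc t)) j - f (Suc t) j = \<alpha> j * nbr_avg G (\<lambda>k. f (Suc t) k - f t k) j"
      by (simp add: rec[of "Suc t"] rec[of t] nbr_avg_diff right_diff_distrib)
    moreover have "\<alpha> j * nbr_avg G (\<lambda>k. f (Suc t) k - f t k) j \<le> a * (C * a ^ t)"
      using Suc.IH nn Suc.prems by (intro weighted_avg_le) (auto simp: abs_le_iff)
    \<comment> \<open>The one-sided bound is applied to the negated increments to obtain the
      absolute value.\<close>
    moreover have "\<alpha> j * nbr_avg G (\<lambda>k. - (f (Suc t) k - f t k)) j \<le> a * (C * a ^ t)"
      using Suc.IH nn Suc.prems by (intro weighted_avg_le) (auto simp: abs_le_iff)
    ultimately show ?case by (simp only: nbr_avg_uminus) (simp add: mult_ac abs_le_iff)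
  qed
  have "convergent (\<lambda>t. f t i)"
    using bound[OF assms] a by (rule convergent_of_geometric_increments)
  then show ?thesis
    using assms by (simp add: convergent_LIMSEQ_iff stable_opinion_def f_def)
qed

lemma stable_opinion_fixpoint:
  assumes "i < n"
  shows "stable_opinion n \<alpha> x0 G $ i =
    \<alpha> i * nbr_avg G (\<lambda>j. stable_opinion n \<alpha> x0 G $ j) i + (1 - \<alpha> i) * x0 $ i"
proof (rule LIMSEQ_unique)
  show "(\<lambda>t. opinion n \<alpha> x0 G (Suc t) $ i) \<longlonglongrightarrow> stable_opinion n \<alpha> x0 G $ i"
    using opinion_tendsto[OF assms] by (rule LIMSEQ_Suc)
  show "(\<lambda>t. opinion n \<alpha> x0 G (Suc t) $ i) \<longlonglongrightarrow>
    \<alpha> i * nbr_avg G (\<lambda>j. stable_opinion n \<alpha> x0 G $ j) i + (1 - \<alpha> i) * x0 $ i"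
    unfolding opinion_Suc[OF assms]
    by (intro tendsto_intros tendsto_nbr_avg[OF edges assms] opinion_tendsto)
qed

text \<open>Comparison principle: the difference of the two solutions is a subsolution with
  nonpositive source, so the maximum principle applies.\<close>

lemma fixpoint_le:
  assumes s: "\<And>i. i < n \<Longrightarrow> s i = \<alpha> i * nbr_avg G s i + b i"
    and s': "\<And>i. i < n \<Longrightarrow> s' i = \<alpha> i * nbr_avg G s' i + b' i"
    and b: "\<And>i. i < n \<Longrightarrow> b i \<le> b' i"
    and i: "i < n"
  shows "s i \<le> s' i"
proof -
  have "s i - s' i \<le> 0"
    using a(2) _ i
  proof (rule maximum_principle)
    fix i m assume i: "i < n" and m: "(0::real) \<le> m" "\<And>j. j < n \<Longrightarrow> s j - s' j \<le> m"
    have "s i - s' i \<le> \<alpha> i * nbr_avg G (\<lambda>j. s j - s' j) i"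
      using s[OF i] s'[OF i] b[OF i] by (simp add: nbr_avg_diff right_diff_distrib)
    also have "\<dots> \<le> a * m" using i m by (rule weighted_avg_le)
    finally show "s i - s' i \<le> a * m" .
  qed
  then show ?thesis by simp
qed

lemma fixpoint_unique:
  assumes "\<And>i. i < n \<Longrightarrow> s i = \<alpha> i * nbr_avg G s i + b i"
    and "\<And>i. i < n \<Longrightarrow> s' i = \<alpha> i * nbr_avg G s' i + b i"
    and "i < n"
  shows "s i = s' i"
  using fixpoint_le[of s b s' b i] fixpoint_le[of s' b s b i] assms by force

text \<open>The constants 0 and 1 solve the fixed-point equation with sources 0 and 1 - \<alpha>,
  between which the actual source lies.\<close>

lemma stable_opinion_bounds:
  assumes x0: "\<And>i. i < n \<Longrightarrow> 0 \<le> x0 $ i \<and> x0 $ i \<le> 1" and i: "i < n"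
  shows "0 \<le> stable_opinion n \<alpha> x0 G $ i" "stable_opinion n \<alpha> x0 G $ i \<le> 1"
proof -
  have \<alpha>: "\<alpha> i \<le> 1" if "i < n" for i using weight(2)[OF that] a by simp
  show "0 \<le> stable_opinion n \<alpha> x0 G $ i"
    by (rule fixpoint_le[where s = "\<lambda>_. 0" and b = "\<lambda>_. 0", OF _ stable_opinion_fixpoint])
       (use x0 i \<alpha> in auto)
  show "stable_opinion n \<alpha> x0 G $ i \<le> 1"
    by (rule fixpoint_le[where s' = "\<lambda>_. 1" and b' = "\<lambda>i. 1 - \<alpha> i", OF stable_opinion_fixpoint])
       (use x0 i \<alpha> in \<open>auto intro: mult_left_le\<close>)
qed

end

subsection \<open>Discounted hitting probabilities\<close>

text \<open>
  \<open>visit n a i G j / (1 - a)\<close> is the expected number of visits to \<open>i\<close> of a random walk on \<open>G\<close>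
  that starts in \<open>j\<close> and survives each step with probability \<open>a\<close>.  Once the out-edges of \<open>i\<close>
  are removed the walk stays in \<open>i\<close>, and \<open>visit\<close> becomes the probability of reaching \<open>i\<close>.
\<close>

definition visit :: "nat \<Rightarrow> real \<Rightarrow> nat \<Rightarrow> digraph \<Rightarrow> nat \<Rightarrow> real" where
  "visit n a i G j = stable_opinion n (\<lambda>_. a) (unit_vec n i) G $ j"

locale discounted =
  fixes n :: nat and a :: real
  assumes a: "0 \<le> a" "a < 1"
begin

lemma averaging_const: "G \<subseteq> possible_edges n \<Longrightarrow> averaging n (\<lambda>_. a) a G"
  using a by unfold_locales auto

lemma visit_fixpoint:
  assumes "G \<subseteq> possible_edges n" "i < n" "j < n"
  shows "visit n a i G j = a * nbr_avg G (visit n a i G) j + (1 - a) * of_bool (j = i)"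
  unfolding visit_def
  using averaging.stable_opinion_fixpoint[OF averaging_const[OF assms(1)] assms(3), of "unit_vec n i"] assms
  by (auto simp: unit_vec_def)

lemma visit_bounds:
  assumes "G \<subseteq> possible_edges n" "j < n"
  shows "0 \<le> visit n a i G j" "visit n a i G j \<le> 1"
  unfolding visit_def
  using assms(2)
  by (auto intro!: averaging.stable_opinion_bounds[OF averaging_const[OF assms(1)]] simp: unit_vec_def)

text \<open>The visits to all targets add up to the expected lifetime 1 / (1 - a) of the walk,
  whatever the graph. Formally, the sum over the targets solves the same equation as the constant
  1.\<close>

lemma sum_visit:
  assumes G: "G \<subseteq> possible_edges n" and j: "j < n"
  shows "(\<Sum>i<n. visit n a i G j) = 1"
proof -
  interpret averaging n "\<lambda>_. a" a G using G by (rule averaging_const)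
  show ?thesis
  proof (rule fixpoint_unique[where s = "\<lambda>j. \<Sum>i<n. visit n a i G j"
        and s' = "\<lambda>_. 1" and b = "\<lambda>_. 1 - a"])
    fix j assume j: "j < n"
    have "(\<Sum>i<n. visit n a i G j) =
        (\<Sum>i<n. a * nbr_avg G (visit n a i G) j + (1 - a) * of_bool (j = i))"
      using visit_fixpoint[OF G _ j] by (intro sum.cong) auto
    also have "\<dots> = a * nbr_avg G (\<lambda>j. \<Sum>i<n. visit n a i G j) j + (1 - a)"
      using j by (simp add: sum.distrib nbr_avg_sum sum_distrib_left[symmetric] of_bool_def)
    finally show "(\<Sum>i<n. visit n a i G j) = \<dots>" .
  qed (use j in auto)
qed

lemma visit_removed_row_self:
  assumes "G \<subseteq> possible_edges n" "i < n"
  shows "visit n a i (G - {i} \<times> UNIV) i = 1"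
proof -
  have "visit n a i (G - {i} \<times> UNIV) i = a * visit n a i (G - {i} \<times> UNIV) i + (1 - a)"
    using visit_fixpoint[of "G - {i} \<times> UNIV" i i] assms by (auto simp: nbr_avg_removed_row)
  then have "(1 - a) * (visit n a i (G - {i} \<times> UNIV) i - 1) = 0"
    by (simp add: algebra_simps)
  with a show ?thesis by simp
qed

text \<open>The walks on the two graphs agree until \<open>i\<close> is reached, and reaching
  \<open>i\<close> produces at least one visit, which contributes 1 - a to \<open>visit\<close> on
  \<open>G\<close>.\<close>

lemma visit_removed_row_le:
  assumes G: "G \<subseteq> possible_edges n" and i: "i < n" and j: "j < n"
  shows "visit n a i (G - {i} \<times> UNIV) j \<le> visit n a i G j / (1 - a)"
proof -
  define h where "h = visit n a i (G - {i} \<times> UNIV)"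
  define g where "g = visit n a i G"
  have G': "G - {i} \<times> UNIV \<subseteq> possible_edges n" using G by auto
  have "(1 - a) * h j - g j \<le> 0"
    using a(2) _ j
  proof (rule maximum_principle)
    fix j m assume j: "j < n" and m: "(0::real) \<le> m" "\<And>k. k < n \<Longrightarrow> (1 - a) * h k - g k \<le> m"
    show "(1 - a) * h j - g j \<le> a * m"
    proof (cases "j = i")
      case True
      have "0 \<le> nbr_avg G g i"
        unfolding g_def using visit_bounds[OF G] by (intro nbr_avg_ge[OF G i]) auto
      \<comment> \<open>The visit at time 0 alone gives this bound.\<close>
      then have "1 - a \<le> g i"
        using visit_fixpoint[OF G i i] a by (simp add: g_def)
      moreover have "h i = 1" unfolding h_def using G i by (rule visit_removed_row_self)
      ultimately show ?thesis using True m a by (simp add: order_trans[of _ 0])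
    next
      case False
      have "h j = a * nbr_avg G h j"
        using visit_fixpoint[OF G' i j] False by (simp add: h_def nbr_avg_remove_row)
      moreover have "g j = a * nbr_avg G g j"
        using visit_fixpoint[OF G i j] False by (simp add: g_def)
      ultimately have "(1 - a) * h j - g j = (1 - a) * (a * nbr_avg G h j) - a * nbr_avg G g j"
        by simp
      also have "\<dots> = a * nbr_avg G (\<lambda>k. (1 - a) * h k - g k) j"
        by (simp only: nbr_avg_diff nbr_avg_cmult) (simp add: algebra_simps)
      also have "\<dots> \<le> a * m"
        using a m by (intro mult_left_mono nbr_avg_le[OF G j]) auto
      finally show ?thesis .
    qed
  qed
  then show ?thesis using a by (simp add: h_def g_def field_simps)
qed

text \<open>Relabelling the nodes turns one fixed-point equation into the other, and its solution is
  unique.\<close>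

lemma visit_permute:
  assumes G: "G \<subseteq> possible_edges n" and ij: "i < n" "j < n"
    and \<pi>: "\<pi> permutes {..<n}"
  shows "visit n a (\<pi> i) (map_prod \<pi> \<pi> ` G) (\<pi> j) = visit n a i G j"
proof -
  interpret averaging n "\<lambda>_. a" a G using G by (rule averaging_const)
  have inj: "inj \<pi>" using \<pi> by (rule permutes_inj)
  have lt: "\<pi> k < n \<longleftrightarrow> k < n" for k using permutes_in_image[OF \<pi>, of k] by simp
  have G': "map_prod \<pi> \<pi> ` G \<subseteq> possible_edges n"
    using G inj lt by (auto simp: possible_edges_def inj_eq)
  show ?thesis
  proof (rule fixpoint_unique[where s = "\<lambda>j. visit n a (\<pi> i) (map_prod \<pi> \<pi> ` G) (\<pi> j)"
        and b = "\<lambda>j. (1 - a) * of_bool (j = i)"])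
    fix j assume "j < n"
    then show "visit n a (\<pi> i) (map_prod \<pi> \<pi> ` G) (\<pi> j) =
        a * nbr_avg G (\<lambda>j. visit n a (\<pi> i) (map_prod \<pi> \<pi> ` G) (\<pi> j)) j + (1 - a) * of_bool (j = i)"
      using visit_fixpoint[OF G', of "\<pi> i" "\<pi> j"] ij inj
      by (simp add: lt nbr_avg_image o_def inj_eq)
  qed (use ij visit_fixpoint[OF G] in auto)
qed

end

text \<open>Outside \<open>i\<close> both opinion vectors are averaged by the same rows, so a
  discrepancy can only originate in \<open>i\<close>, where it is at most 1 because opinions lie in
  [0,1]. It reaches \<open>j\<close> damped by at least the factor \<open>a\<close> per step, hence
  with at most the discounted hitting probability.\<close>

lemma (in averaging) remove_row_diff_le:
  assumes x0: "\<And>i. i < n \<Longrightarrow> 0 \<le> x0 $ i \<and> x0 $ i \<le> 1" and i: "i < n" and j: "j < n"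
  shows "\<bar>stable_opinion n \<alpha> x0 G $ j - stable_opinion n \<alpha> x0 (G - {i} \<times> UNIV) $ j\<bar>
    \<le> visit n a i (G - {i} \<times> UNIV) j"
proof -
  define G' where "G' = G - {i} \<times> UNIV"
  define h where "h = visit n a i G'"
  define x where "x j = stable_opinion n \<alpha> x0 G $ j" for j
  define z where "z j = stable_opinion n \<alpha> x0 G' $ j" for j
  have G': "G' \<subseteq> possible_edges n" unfolding G'_def using edges by auto
  interpret G': averaging n \<alpha> a G' using G' weight a by unfold_locales auto
  interpret discounted n a using a by unfold_locales auto
  note xb = stable_opinion_bounds[OF x0, folded x_def]
  note zb = G'.stable_opinion_bounds[OF x0, folded z_def]
  \<comment> \<open>The sign \<open>c\<close> covers both halves of the absolute value with one
    argument.\<close>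
  have le: "c * (x j - z j) - h j \<le> 0" if c: "\<bar>c\<bar> = 1" for c :: real
    using a(2) _ j
  proof (rule maximum_principle)
    fix j m assume j: "j < n" and m: "(0::real) \<le> m" "\<And>k. k < n \<Longrightarrow> c * (x k - z k) - h k \<le> m"
    show "c * (x j - z j) - h j \<le> a * m"
    proof (cases "j = i")
      case True
      have "h i = 1" unfolding h_def G'_def using edges i by (rule visit_removed_row_self)
      moreover have "c * (x i - z i) \<le> 1"
        using xb[of i] zb[of i] c i by (auto simp: abs_if split: if_splits)
      moreover have "0 \<le> a * m" using a m by simp
      ultimately show ?thesis using True by simp
    next
      case False
      have avg: "nbr_avg G' f j = nbr_avg G f j" for f
        unfolding G'_def using False by (rule nbr_avg_remove_row)
      \<comment> \<open>\<open>h\<close> solves its equation with the constant weight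
        \<open>a\<close>; being nonnegative, it is a supersolution for the smaller weights
        \<alpha>.\<close>
      have "0 \<le> nbr_avg G h j"
        unfolding h_def using visit_bounds[OF G'] by (intro nbr_avg_ge[OF edges j]) auto
      then have "\<alpha> j * nbr_avg G h j \<le> a * nbr_avg G h j"
        using weight(2)[OF j] by (rule mult_right_mono[rotated])
      also have "\<dots> = h j"
        using visit_fixpoint[OF G' i j] False by (simp add: h_def avg)
      finally have "c * (x j - z j) - h j \<le>
          c * (\<alpha> j * nbr_avg G x j - \<alpha> j * nbr_avg G z j) - \<alpha> j * nbr_avg G h j"
        using stable_opinion_fixpoint[OF j, of x0, folded x_def]
          G'.stable_opinion_fixpoint[OF j, of x0, folded z_def]
        by (simp add: avg)
      also have "\<dots> = \<alpha> j * nbr_avg G (\<lambda>k. c * (x k - z k) - h k) j"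
        by (simp only: nbr_avg_diff nbr_avg_cmult) (simp add: algebra_simps)
      also have "\<dots> \<le> a * m" using j m by (rule weighted_avg_le)
      finally show ?thesis .
    qed
  qed
  show ?thesis
    using le[of 1] le[of "-1"] by (simp add: abs_le_iff x_def z_def h_def G'_def)
qed

subsection \<open>Random edge sets\<close>

lemma finite_possible_edges [simp]: "finite (possible_edges n)"
  by (rule finite_subset[of _ "{..<n} \<times> {..<n}"]) (auto simp: possible_edges_def)

text \<open>Stated for an arbitrary set of possible edges, so that the out-edges of one node and the
  remaining edges can be sampled separately.\<close>

definition random_edges :: "'e set \<Rightarrow> real \<Rightarrow> 'e set pmf" where
  "random_edges E p = map_pmf (\<lambda>f. {e \<in> E. f e}) (Pi_pmf E False (\<lambda>_. bernoulli_pmf p))"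

lemma random_digraph_eq: "random_digraph n p = random_edges (possible_edges n) p"
  by (simp add: random_digraph_def random_edges_def)

lemma set_random_edges: "set_pmf (random_edges E p) \<subseteq> Pow E"
  by (auto simp: random_edges_def)

lemma finite_set_random_edges: "finite E \<Longrightarrow> finite (set_pmf (random_edges E p))"
  using set_random_edges by (rule finite_subset) simp

lemma random_edges_union:
  assumes "finite E" "finite F" "E \<inter> F = {}"
  shows "random_edges (E \<union> F) p =
    map_pmf (\<lambda>(A, B). A \<union> B) (pair_pmf (random_edges E p) (random_edges F p))"
proof -
  have "random_edges (E \<union> F) p = map_pmf (\<lambda>(f, g). {e \<in> E. f e} \<union> {e \<in> F. g e})
      (pair_pmf (Pi_pmf E False (\<lambda>_. bernoulli_pmf p)) (Pi_pmf F False (\<lambda>_. bernoulli_pmf p)))"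
    unfolding random_edges_def Pi_pmf_union[OF assms] map_pmf_comp
    using assms(3) by (intro map_pmf_cong) auto
  also have "\<dots> = map_pmf (\<lambda>(A, B). A \<union> B) (pair_pmf (random_edges E p) (random_edges F p))"
    unfolding random_edges_def map_pair[symmetric] map_pmf_comp
    by (intro map_pmf_cong) auto
  finally show ?thesis .
qed

text \<open>The edge indicators are independent with a common law, so permuting them does not change
  their joint law.\<close>

lemma random_edges_image:
  assumes "finite E" "bij h" "h ` E = E"
  shows "map_pmf ((`) h) (random_edges E p) = random_edges E p"
proof -
  have inj: "inj h" using assms(2) by (rule bij_is_inj)
  have *: "Pi_pmf E False (\<lambda>_. bernoulli_pmf p) =
      map_pmf (\<lambda>g. g \<circ> h) (Pi_pmf E False (\<lambda>_. bernoulli_pmf p))"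
  proof (rule Pi_pmf_bij_betw[OF assms(1)])
    show "bij_betw h E E"
      using inj_on_subset[OF inj] assms(3) by (simp add: bij_betw_def)
    show "h x \<notin> E" if "x \<notin> E" for x
      \<comment> \<open>Off \<open>E\<close> the indicators have the default value
        \<open>False\<close>, so \<open>h\<close> has to preserve the complement of \<open>E\<close>
        as well.\<close>
      using that inj_image_mem_iff[OF inj, of x E] assms(3) by simp
  qed
  have "map_pmf ((`) h) (random_edges E p) =
      map_pmf (\<lambda>g. h ` {e \<in> E. g (h e)}) (Pi_pmf E False (\<lambda>_. bernoulli_pmf p))"
    unfolding random_edges_def map_pmf_comp by (subst *) (simp add: map_pmf_comp)
  also have "\<dots> = random_edges E p"
    unfolding random_edges_def
  proof (intro map_pmf_cong refl)
    fix g :: "'a \<Rightarrow> bool"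
    show "h ` {e \<in> E. g (h e)} = {e \<in> E. g e}"
      using assms(3) by auto
  qed
  finally show ?thesis .
qed

lemma prob_random_edges_empty:
  assumes "finite E" "0 \<le> p" "p \<le> 1"
  shows "measure_pmf.prob (random_edges E p) {{}} = (1 - p) ^ card E"
proof -
  have "(\<lambda>f. {e \<in> E. f e}) -` {{}} = Pi E (\<lambda>_. {False})"
    by auto
  then show ?thesis
    using assms
    by (simp only: random_edges_def measure_map_pmf)
       (simp add: measure_Pi_pmf_Pi measure_pmf_single del: Pi_I Pi_iff)
qed

lemma expectation_pair_pmf_mult:
  fixes f :: "'a \<Rightarrow> real" and g :: "'b \<Rightarrow> real"
  assumes "finite (set_pmf P)" "finite (set_pmf Q)"
  shows "measure_pmf.expectation (pair_pmf P Q) (\<lambda>(x, y). f x * g y) =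
    measure_pmf.expectation P f * measure_pmf.expectation Q g"
  using assms
  by (subst (1 2 3) integral_measure_pmf_real[OF _ ])
    (auto simp: sum_product sum.cartesian_product pmf_pair mult_ac intro!: sum.cong)

section \<open>Independence of rows and exchangeability of nodes in the random digraph\<close>

lemma set_random_digraph: "G \<in> set_pmf (random_digraph n p) \<Longrightarrow> G \<subseteq> possible_edges n"
  using set_random_edges by (auto simp: random_digraph_eq)

lemma integrable_random_digraph [simp]:
  fixes f :: "digraph \<Rightarrow> real"
  shows "integrable (measure_pmf (random_digraph n p)) f"
  by (rule integrable_measure_pmf_finite) (simp add: random_digraph_eq finite_set_random_edges)

lemma random_digraph_split:
  "random_digraph n p = map_pmf (\<lambda>(A, B). A \<union> B)
     (pair_pmf (random_edges (possible_edges n \<inter> {i} \<times> UNIV) p)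
       (random_edges (possible_edges n - {i} \<times> UNIV) p))"
proof -
  have "random_digraph n p =
      random_edges ((possible_edges n \<inter> {i} \<times> UNIV) \<union> (possible_edges n - {i} \<times> UNIV)) p"
    unfolding random_digraph_eq by (simp add: Int_Diff_Un)
  then show ?thesis by (subst (asm) random_edges_union) auto
qed

text \<open>The out-edges of \<open>i\<close> are independent of all other edges. Below,
  \<open>f\<close> will be an entry of row \<open>i\<close> of H(G), and \<open>g\<close> an opinion
  or a hitting probability on the cut graph.\<close>

lemma expectation_mult_row:
  fixes f g :: "digraph \<Rightarrow> real"
  shows "measure_pmf.expectation (random_digraph n p)
      (\<lambda>G. f (G \<inter> {i} \<times> UNIV) * g (G - {i} \<times> UNIV)) =
    measure_pmf.expectation (random_digraph n p) (\<lambda>G. f (G \<inter> {i} \<times> UNIV)) *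
    measure_pmf.expectation (random_digraph n p) (\<lambda>G. g (G - {i} \<times> UNIV))"
proof -
  define P where "P = random_edges (possible_edges n \<inter> {i} \<times> UNIV) p"
  define Q where "Q = random_edges (possible_edges n - {i} \<times> UNIV) p"
  have D: "random_digraph n p = map_pmf (\<lambda>(A, B). A \<union> B) (pair_pmf P Q)"
    unfolding P_def Q_def by (rule random_digraph_split)
  have fin: "finite (set_pmf P)" "finite (set_pmf Q)"
    unfolding P_def Q_def by (simp_all add: finite_set_random_edges)
  have sub: "A \<subseteq> {i} \<times> UNIV" "B \<inter> {i} \<times> UNIV = {}" if "(A, B) \<in> set_pmf (pair_pmf P Q)" for A B
    using that set_random_edges[of "possible_edges n \<inter> {i} \<times> UNIV" p]
      set_random_edges[of "possible_edges n - {i} \<times> UNIV" p]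
    unfolding P_def Q_def by auto
  have row: "(A \<union> B) \<inter> {i} \<times> UNIV = A" "(A \<union> B) - {i} \<times> UNIV = B"
    if "(A, B) \<in> set_pmf (pair_pmf P Q)" for A B
    using sub[OF that] by auto
  have E: "measure_pmf.expectation (random_digraph n p)
      (\<lambda>G. f (G \<inter> {i} \<times> UNIV) * g (G - {i} \<times> UNIV)) =
      measure_pmf.expectation P f * measure_pmf.expectation Q g" for f g :: "digraph \<Rightarrow> real"
  proof -
    have "measure_pmf.expectation (random_digraph n p)
        (\<lambda>G. f (G \<inter> {i} \<times> UNIV) * g (G - {i} \<times> UNIV)) =
        measure_pmf.expectation (pair_pmf P Q) (\<lambda>(A, B). f A * g B)"
      unfolding D integral_map_pmf
      by (rule integral_cong_AE) (auto simp: AE_measure_pmf_iff row simp del: set_pair_pmf)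
    then show ?thesis using expectation_pair_pmf_mult[OF fin, of f g] by simp
  qed
  show ?thesis
    \<comment> \<open>Taking one factor to be the constant 1 identifies the two marginal
      expectations.\<close>
    using E[of f g] E[of f "\<lambda>_. 1"] E[of "\<lambda>_. 1" g] by simp
qed

lemma prob_out_deg_0:
  assumes "i < n" "0 \<le> p" "p \<le> 1"
  shows "measure_pmf.prob (random_digraph n p) {G. out_deg G i = 0} = (1 - p) ^ (n - 1)"
proof -
  let ?E = "possible_edges n \<inter> {i} \<times> UNIV"
  let ?P = "random_edges ?E p" and ?Q = "random_edges (possible_edges n - {i} \<times> UNIV) p"
  have "?E = {i} \<times> ({..<n} - {i})"
    using assms by (auto simp: possible_edges_def)
  then have card: "card ?E = n - 1"
    using assms by (simp add: card_cartesian_product)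
  have *: "out_deg (A \<union> B) i = 0 \<longleftrightarrow> A = {}" if "(A, B) \<in> set_pmf (pair_pmf ?P ?Q)" for A B
  proof -
    have A: "A \<subseteq> ?E" and B: "B \<subseteq> possible_edges n - {i} \<times> UNIV"
      using that set_random_edges[of ?E p] set_random_edges[of "possible_edges n - {i} \<times> UNIV" p]
      by auto
    \<comment> \<open>\<open>card\<close> is 0 on infinite sets too, so only finiteness makes
      out-degree 0 mean that there are no out-neighbours.\<close>
    have "finite (out_nbrs (A \<union> B) i)"
      by (rule finite_subset[OF out_nbrs_subset[of _ n]]) (use A B in auto)
    moreover have "out_nbrs (A \<union> B) i = {} \<longleftrightarrow> A = {}"
      using A B by (auto simp: out_nbrs_def)
    ultimately show ?thesis by (simp add: out_deg_def)
  qed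
  have "measure_pmf.prob (random_digraph n p) {G. out_deg G i = 0} =
      measure_pmf.prob (pair_pmf ?P ?Q) {x. fst x = {}}"
    unfolding random_digraph_split[of n p i] measure_map_pmf
    by (intro measure_pmf.finite_measure_eq_AE)
       (auto simp: AE_measure_pmf_iff * split_beta simp del: set_pair_pmf)
  also have "\<dots> = measure_pmf.prob (map_pmf fst (pair_pmf ?P ?Q)) {{}}"
    by (simp only: measure_map_pmf) (simp add: vimage_def)
  also have "\<dots> = (1 - p) ^ (n - 1)"
    using assms card by (simp add: map_fst_pair_pmf prob_random_edges_empty)
  finally show ?thesis .
qed

lemma expectation_permute:
  fixes f :: "digraph \<Rightarrow> real"
  assumes "\<pi> permutes {..<n}"
  shows "measure_pmf.expectation (random_digraph n p) (\<lambda>G. f (map_prod \<pi> \<pi> ` G)) =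
    measure_pmf.expectation (random_digraph n p) f"
proof -
  have bij: "bij (map_prod \<pi> \<pi>)"
    using permutes_inj[OF assms] permutes_surj[OF assms]
    by (simp add: bij_def prod.inj_map map_prod_surj)
  have "map_prod \<pi> \<pi> ` possible_edges n \<subseteq> possible_edges n"
  proof
    fix e assume "e \<in> map_prod \<pi> \<pi> ` possible_edges n"
    then obtain i j where "e = (\<pi> i, \<pi> j)" "i < n" "j < n" "i \<noteq> j"
      by (auto simp: possible_edges_def)
    then show "e \<in> possible_edges n"
      using permutes_in_image[OF assms, of i] permutes_in_image[OF assms, of j] permutes_inj[OF assms]
      by (simp add: possible_edges_def inj_eq)
  qed
  moreover have "inj_on (map_prod \<pi> \<pi>) (possible_edges n)"
    using bij by (blast intro: inj_on_subset bij_is_inj)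
  ultimately have "map_prod \<pi> \<pi> ` possible_edges n = possible_edges n"
    by (simp add: endo_inj_surj)
  with bij have *: "map_pmf ((`) (map_prod \<pi> \<pi>)) (random_digraph n p) = random_digraph n p"
    unfolding random_digraph_eq by (intro random_edges_image) simp_all
  show ?thesis
    using integral_map_pmf[of "(`) (map_prod \<pi> \<pi>)" "random_digraph n p" f] unfolding * by simp
qed

text \<open>By exchangeability the n - 1 targets other than \<open>j\<close> have equal
  expectations, and by \<open>sum_visit\<close> these add up to at most 1.\<close>

lemma (in discounted) expectation_visit_le:
  assumes "i < n" "j < n" "i \<noteq> j"
  shows "measure_pmf.expectation (random_digraph n p) (\<lambda>G. visit n a i G j) \<le> 1 / (real n - 1)"
proof -
  let ?E = "measure_pmf.expectation (random_digraph n p)"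
  have sym: "?E (\<lambda>G. visit n a k G j) = ?E (\<lambda>G. visit n a i G j)" if k: "k < n" "k \<noteq> j" for k
  proof -
    \<comment> \<open>Both \<open>i\<close> and \<open>k\<close> differ from \<open>j\<close>, so
      the transposition moves the target but keeps the starting point.\<close>
    define \<pi> where "\<pi> = Transposition.transpose i k"
    have \<pi>: "\<pi> permutes {..<n}"
      unfolding \<pi>_def using assms k by (intro permutes_swap_id) auto
    have [simp]: "\<pi> i = k" "\<pi> j = j" unfolding \<pi>_def using assms k by auto
    have "?E (\<lambda>G. visit n a k G j) = ?E (\<lambda>G. visit n a k (map_prod \<pi> \<pi> ` G) j)"
      by (rule expectation_permute[OF \<pi>, symmetric])
    also have "\<dots> = ?E (\<lambda>G. visit n a i G j)"
      using visit_permute[OF set_random_digraph _ _ \<pi>, of _ p i j] assms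
      by (intro integral_cong_AE) (auto simp: AE_measure_pmf_iff)
    finally show ?thesis .
  qed
  have "(real n - 1) * ?E (\<lambda>G. visit n a i G j) = (\<Sum>k\<in>{..<n} - {j}. ?E (\<lambda>G. visit n a i G j))"
    using assms by (simp add: of_nat_diff)
  also have "\<dots> = (\<Sum>k\<in>{..<n} - {j}. ?E (\<lambda>G. visit n a k G j))"
    using sym by (intro sum.cong) auto
  also have "\<dots> = ?E (\<lambda>G. \<Sum>k\<in>{..<n} - {j}. visit n a k G j)"
    by simp
  also have "\<dots> \<le> ?E (\<lambda>_. 1)"
  proof (rule integral_mono_AE)
    have "(\<Sum>k\<in>{..<n} - {j}. visit n a k G j) \<le> 1" if "G \<in> set_pmf (random_digraph n p)" for G
    proof -
      note G = set_random_digraph[OF that]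
      have "(\<Sum>k\<in>{..<n} - {j}. visit n a k G j) \<le> (\<Sum>k<n. visit n a k G j)"
        using visit_bounds[OF G] assms by (intro sum_mono2) auto
      then show ?thesis using sum_visit[OF G] assms by simp
    qed
    then show "AE G in random_digraph n p. (\<Sum>k\<in>{..<n} - {j}. visit n a k G j) \<le> 1"
      by (simp add: AE_measure_pmf_iff)
  qed auto
  finally have "(real n - 1) * ?E (\<lambda>G. visit n a i G j) \<le> 1" by simp
  then show ?thesis using assms by (simp add: field_simps)
qed

subsection \<open>Mean-field matrix\<close>

lemma sum_H_mat:
  assumes G: "G \<subseteq> possible_edges n" and i: "i < n"
  shows "(\<Sum>j<n. H_mat n \<alpha> G $$ (i, j) * f j) = \<alpha> i * nbr_avg G f i"
proof (cases "out_deg G i > 0")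
  case True
  have "(\<Sum>j<n. H_mat n \<alpha> G $$ (i, j) * f j) =
      (\<Sum>j<n. if j \<in> out_nbrs G i then \<alpha> i / real (out_deg G i) * f j else 0)"
    using i True by (intro sum.cong) (auto simp: H_mat_def out_nbrs_def)
  also have "\<dots> = (\<Sum>j\<in>out_nbrs G i. \<alpha> i / real (out_deg G i) * f j)"
    using out_nbrs_subset[OF G, of i] by (simp add: sum.If_cases Int_absorb1)
  finally show ?thesis
    using True by (simp add: nbr_avg_def sum_distrib_left sum_divide_distrib)
next
  case False
  have "(\<Sum>j<n. H_mat n \<alpha> G $$ (i, j) * f j) = (\<Sum>j<n. if j = i then \<alpha> i * f j else 0)"
    using i False by (intro sum.cong) (auto simp: H_mat_def)
  then show ?thesis using i False by (simp add: nbr_avg_def)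
qed

text \<open>Row \<open>i\<close> is a function of the out-edges of \<open>i\<close> alone, which
  makes \<open>expectation_mult_row\<close> applicable to it.\<close>

lemma H_mat_row:
  assumes "i < n" "j < n"
  shows "H_mat n \<alpha> (G \<inter> {i} \<times> UNIV) $$ (i, j) = H_mat n \<alpha> G $$ (i, j)"
proof -
  have "out_nbrs (G \<inter> {i} \<times> UNIV) i = out_nbrs G i" by (auto simp: out_nbrs_def)
  then show ?thesis using assms by (simp add: H_mat_def out_deg_def)
qed

lemma H_mat_nonneg: "i < n \<Longrightarrow> j < n \<Longrightarrow> 0 \<le> \<alpha> i \<Longrightarrow> 0 \<le> H_mat n \<alpha> G $$ (i, j)"
  by (simp add: H_mat_def)

lemma expected_H_index:
  "i < n \<Longrightarrow> j < n \<Longrightarrow> expected_H n p \<alpha> $$ (i, j) =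
    measure_pmf.expectation (random_digraph n p) (\<lambda>G. H_mat n \<alpha> G $$ (i, j))"
  by (simp add: expected_H_def)

lemma expected_H_nonneg:
  "i < n \<Longrightarrow> j < n \<Longrightarrow> 0 \<le> \<alpha> i \<Longrightarrow> 0 \<le> expected_H n p \<alpha> $$ (i, j)"
  by (simp add: expected_H_index H_mat_nonneg)

text \<open>Every realisation of H(G) already has this row sum, nodes of out-degree 0
  included.\<close>

lemma expected_H_row_sum:
  assumes "i < n"
  shows "(\<Sum>j<n. expected_H n p \<alpha> $$ (i, j)) = \<alpha> i"
proof -
  let ?E = "measure_pmf.expectation (random_digraph n p)"
  have "(\<Sum>j<n. expected_H n p \<alpha> $$ (i, j)) = ?E (\<lambda>G. \<Sum>j<n. H_mat n \<alpha> G $$ (i, j))"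
    using assms by (simp add: expected_H_index)
  also have "\<dots> = ?E (\<lambda>_. \<alpha> i)"
    using sum_H_mat[OF set_random_digraph assms, of _ p \<alpha> "\<lambda>_. 1"]
    by (intro integral_cong_AE) (auto simp: AE_measure_pmf_iff)
  finally show ?thesis by simp
qed

text \<open>There are no loops, so a diagonal entry can be nonzero only at out-degree 0. This
  controls the summand j = i of the bias, where the hitting probability is 1 and gives no
  decay.\<close>

lemma expected_H_diag_le:
  assumes "i < n" "0 \<le> p" "p \<le> 1" "0 \<le> \<alpha> i" "\<alpha> i \<le> 1"
  shows "expected_H n p \<alpha> $$ (i, i) \<le> (1 - p) ^ (n - 1)"
proof -
  let ?E = "measure_pmf.expectation (random_digraph n p)"
  have "H_mat n \<alpha> G $$ (i, i) \<le> indicator {G. out_deg G i = 0} G"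
    if "G \<in> set_pmf (random_digraph n p)" for G
    using set_random_digraph[OF that] assms by (auto simp: H_mat_def possible_edges_def)
  then have "?E (\<lambda>G. H_mat n \<alpha> G $$ (i, i)) \<le> ?E (indicator {G. out_deg G i = 0})"
    by (intro integral_mono_AE) (auto simp: AE_measure_pmf_iff)
  then show ?thesis
    using prob_out_deg_0[OF assms(1-3)] assms by (simp add: expected_H_index)
qed

lemma expected_H_carrier: "expected_H n p \<alpha> \<in> carrier_mat n n"
  by (simp add: expected_H_def)

section \<open>Neumann series of the mean-field dynamics\<close>

lemma pow_mat_mult_vec_Suc:
  fixes M :: "real mat"
  assumes M: "M \<in> carrier_mat n n" and v: "v \<in> carrier_vec n" and i: "i < n"
  shows "(M ^\<^sub>m Suc k *\<^sub>v v) $ i = (\<Sum>j<n. M $$ (i, j) * (M ^\<^sub>m k *\<^sub>v v) $ j)"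
proof -
  \<comment> \<open>Matrix powers are defined with the new factor on the right; it is moved to the
    left to expose a row of \<open>M\<close>.\<close>
  have "M ^\<^sub>m Suc k = M * M ^\<^sub>m k"
    using M by (induction k) (simp_all add: assoc_mult_mat[of _ n n _ n _ n] pow_carrier_mat)
  then have "M ^\<^sub>m Suc k *\<^sub>v v = M *\<^sub>v (M ^\<^sub>m k *\<^sub>v v)"
    using assoc_mult_mat_vec[OF M pow_carrier_mat[OF M] v] by simp
  then show ?thesis
    using M i v by (simp add: scalar_prod_def lessThan_atLeast0)
qed

lemma pow_mat_mult_vec_le:
  fixes M :: "real mat"
  assumes M: "M \<in> carrier_mat n n" and v: "v \<in> carrier_vec n"
    and row: "\<And>i. i < n \<Longrightarrow> (\<Sum>j<n. \<bar>M $$ (i, j)\<bar>) \<le> a" and a: "0 \<le> a" and i: "i < n"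
  shows "\<bar>(M ^\<^sub>m k *\<^sub>v v) $ i\<bar> \<le> (\<Sum>j<n. \<bar>v $ j\<bar>) * a ^ k"
  using i
proof (induction k arbitrary: i)
  case 0
  then show ?case using M v by (auto intro!: member_le_sum)
next
  case (Suc k)
  let ?C = "\<Sum>j<n. \<bar>v $ j\<bar>"
  have C: "0 \<le> ?C * a ^ k" using a by (simp add: sum_nonneg)
  have "\<bar>(M ^\<^sub>m Suc k *\<^sub>v v) $ i\<bar> \<le> (\<Sum>j<n. \<bar>M $$ (i, j)\<bar> * \<bar>(M ^\<^sub>m k *\<^sub>v v) $ j\<bar>)"
    unfolding pow_mat_mult_vec_Suc[OF M v Suc.prems]
    by (rule order_trans[OF sum_abs]) (simp add: abs_mult)
  also have "\<dots> \<le> (\<Sum>j<n. \<bar>M $$ (i, j)\<bar> * (?C * a ^ k))"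
    using Suc.IH by (intro sum_mono mult_left_mono) auto
  also have "\<dots> \<le> a * (?C * a ^ k)"
    unfolding sum_distrib_right[symmetric] using row[OF Suc.prems] C by (rule mult_right_mono)
  finally show ?case by (simp add: mult_ac)
qed

text \<open>The term with \<open>x0\<close> vanishes geometrically and the sum tends to the Neumann
  series of \<open>b\<close>. Splitting off the first term of the series gives the fixed-point
  equation.\<close>

lemma mean_field_stable_fixpoint:
  assumes x0: "x0 \<in> carrier_vec n"
    and \<alpha>: "\<And>i. i < n \<Longrightarrow> 0 \<le> \<alpha> i" "\<And>i. i < n \<Longrightarrow> \<alpha> i \<le> a" and a: "0 \<le> a" "a < 1"
    and i: "i < n"
  shows "mean_field_stable n p \<alpha> x0 $ i =
    (\<Sum>j<n. expected_H n p \<alpha> $$ (i, j) * mean_field_stable n p \<alpha> x0 $ j) + (1 - \<alpha> i) * x0 $ i"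
proof -
  define M where "M = expected_H n p \<alpha>"
  define b where "b = B_mat n \<alpha> *\<^sub>v x0"
  have M: "M \<in> carrier_mat n n" unfolding M_def by (rule expected_H_carrier)
  have B: "B_mat n \<alpha> \<in> carrier_mat n n" by (simp add: B_mat_def mat_diag_def)
  have b: "b \<in> carrier_vec n" unfolding b_def using B x0 by (rule mult_mat_vec_carrier)
  have b_index: "b $ i = (1 - \<alpha> i) * x0 $ i" if "i < n" for i
    using x0 that by (simp add: b_def B_mat_def mat_diag_mult_left mat_diag_def scalar_prod_def
        if_distrib[of "\<lambda>x. x * _"] cong: if_cong)
  have row: "(\<Sum>j<n. \<bar>M $$ (i, j)\<bar>) \<le> a" if "i < n" for i
    using that \<alpha> expected_H_row_sum[OF that, of p \<alpha>] by (simp add: M_def expected_H_nonneg)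
  define S where "S i = (\<Sum>k. (M ^\<^sub>m k *\<^sub>v b) $ i)" for i
  have summ: "summable (\<lambda>k. (M ^\<^sub>m k *\<^sub>v b) $ i)" if "i < n" for i
    by (rule summable_comparison_test'[where g = "\<lambda>k. (\<Sum>j<n. \<bar>b $ j\<bar>) * a ^ k" and N = 0])
      (use a pow_mat_mult_vec_le[OF M b row a(1) that] in \<open>auto intro!: summable_mult summable_geometric\<close>)
  have stable: "mean_field_stable n p \<alpha> x0 $ i = S i" if i: "i < n" for i
  proof -
    have "(\<lambda>k. (\<Sum>j<n. \<bar>x0 $ j\<bar>) * a ^ k) \<longlonglongrightarrow> 0"
      using a by (auto intro!: tendsto_mult_right_zero LIMSEQ_realpow_zero)
    then have "(\<lambda>t. (M ^\<^sub>m t *\<^sub>v x0) $ i) \<longlonglongrightarrow> 0"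
      by (rule Lim_null_comparison[rotated])
        (use pow_mat_mult_vec_le[OF M x0 row a(1) i] in auto)
    moreover have "(\<lambda>t. \<Sum>k<t. (M ^\<^sub>m k *\<^sub>v b) $ i) \<longlonglongrightarrow> S i"
      unfolding S_def using summ[OF i] by (rule summable_LIMSEQ)
    ultimately have "(\<lambda>t. (M ^\<^sub>m t *\<^sub>v x0) $ i + (\<Sum>k<t. (M ^\<^sub>m k *\<^sub>v b) $ i)) \<longlonglongrightarrow> 0 + S i"
      by (rule tendsto_add)
    moreover have "mean_field n p \<alpha> x0 (Suc t) $ i =
        (M ^\<^sub>m t *\<^sub>v x0) $ i + (\<Sum>k<t. (M ^\<^sub>m k *\<^sub>v b) $ i)" for t
      using i M by (simp add: M_def b_def)
    ultimately have "(\<lambda>t. mean_field n p \<alpha> x0 (Suc t) $ i) \<longlonglongrightarrow> S i"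
      by simp
    \<comment> \<open>At time t + 1 the recursion carries the t-th power, so the limit is computed
      along the shifted sequence.\<close>
    then have "(\<lambda>t. mean_field n p \<alpha> x0 t $ i) \<longlonglongrightarrow> S i"
      by (rule LIMSEQ_imp_Suc)
    then show ?thesis using i by (simp add: mean_field_stable_def limI)
  qed
  have "S i = (M ^\<^sub>m 0 *\<^sub>v b) $ i + (\<Sum>k. (M ^\<^sub>m Suc k *\<^sub>v b) $ i)"
    unfolding S_def using suminf_split_head[OF summ[OF i]] by simp
  also have "(\<Sum>k. (M ^\<^sub>m Suc k *\<^sub>v b) $ i) = (\<Sum>k. \<Sum>j<n. M $$ (i, j) * (M ^\<^sub>m k *\<^sub>v b) $ j)"
    by (simp only: pow_mat_mult_vec_Suc[OF M b i])
  also have "\<dots> = (\<Sum>j<n. M $$ (i, j) * S j)"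
    unfolding S_def using summ
    by (subst suminf_sum) (auto intro!: summable_mult sum.cong suminf_mult)
  finally show ?thesis
    using i M b b_index by (simp add: stable M_def[symmetric])
qed

subsection \<open>The entrywise bias\<close>

text \<open>The defect is the sum over j of the covariances of H_ij and x_j. Replacing x_j by its
  value z_j on the graph without the out-edges of \<open>i\<close> makes them vanish. The
  replacement costs at most M_j E h_j in each of the two terms of a covariance, which yields the
  factor 2.\<close>

lemma expectation_fixpoint_residual:
  assumes av: "\<And>i. i < n \<Longrightarrow> 0 \<le> \<alpha> i" "\<And>i. i < n \<Longrightarrow> \<alpha> i \<le> a" "0 \<le> a" "a < 1"
    and p: "0 \<le> p" "p \<le> 1"
    and x0: "\<And>i. i < n \<Longrightarrow> 0 \<le> x0 $ i \<and> x0 $ i \<le> 1" and i: "i < n" and n: "2 \<le> n"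
  shows "\<bar>expected_stable_opinion n p \<alpha> x0 $ i -
      ((\<Sum>j<n. expected_H n p \<alpha> $$ (i, j) * expected_stable_opinion n p \<alpha> x0 $ j)
        + (1 - \<alpha> i) * x0 $ i)\<bar>
    \<le> 2 * ((1 - p) ^ (n - 1) + 1 / ((1 - a) * (real n - 1)))"
proof -
  define E :: "(digraph \<Rightarrow> real) \<Rightarrow> real" where "E = measure_pmf.expectation (random_digraph n p)"
  define x where "x G j = stable_opinion n \<alpha> x0 G $ j" for G j
  define z where "z G j = x (G - {i} \<times> UNIV) j" for G j
  define h where "h G j = visit n a i (G - {i} \<times> UNIV) j" for G j
  define H where "H G j = H_mat n \<alpha> G $$ (i, j)" for G j
  define M where "M j = expected_H n p \<alpha> $$ (i, j)" for j
  define K where "K = 1 / ((1 - a) * (real n - 1))"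
  interpret discounted n a using av by unfold_locales auto
  have K: "0 \<le> K" using av n by (simp add: K_def)
  have avg: "averaging n \<alpha> a G" if "G \<in> set_pmf (random_digraph n p)" for G
    using set_random_digraph[OF that] av by unfold_locales auto
  have E_cong: "E f = E g" if "\<And>G. G \<in> set_pmf (random_digraph n p) \<Longrightarrow> f G = g G" for f g
    unfolding E_def using that by (intro integral_cong_AE) (auto simp: AE_measure_pmf_iff)
  have E_mono: "E f \<le> E g" if "\<And>G. G \<in> set_pmf (random_digraph n p) \<Longrightarrow> f G \<le> g G" for f g
    unfolding E_def using that by (intro integral_mono_AE) (auto simp: AE_measure_pmf_iff)
  have E_add: "E (\<lambda>G. f G + g G) = E f + E g" for f g
    unfolding E_def by simp
  have E_sum: "E (\<lambda>G. \<Sum>j<n. f j G) = (\<Sum>j<n. E (f j))" for f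
    unfolding E_def by simp
  have E_abs: "\<bar>E f\<bar> \<le> E (\<lambda>G. \<bar>f G\<bar>)" for f
    unfolding E_def by (rule integral_abs_bound)
  have M_E: "M j = E (\<lambda>G. H G j)" if "j < n" for j
    using i that by (simp add: M_def E_def H_def expected_H_index)
  have M_nonneg: "0 \<le> M j" if "j < n" for j
    unfolding M_def using i that av by (intro expected_H_nonneg) auto
  have indep: "E (\<lambda>G. H G j * f (G - {i} \<times> UNIV)) = M j * E (\<lambda>G. f (G - {i} \<times> UNIV))"
    if "j < n" for j f
    using expectation_mult_row[of n p "\<lambda>G. H G j" i f] i that
    by (simp add: H_def H_mat_row M_E E_def)
  have d: "\<bar>x G j - z G j\<bar> \<le> h G j" if "G \<in> set_pmf (random_digraph n p)" "j < n" for G j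
    unfolding x_def z_def h_def
    using averaging.remove_row_diff_le[OF avg[OF that(1)] x0 i that(2)] .
  have x_fix: "E (\<lambda>G. x G i) = (\<Sum>j<n. E (\<lambda>G. H G j * x G j)) + (1 - \<alpha> i) * x0 $ i"
  proof -
    have "E (\<lambda>G. x G i) = E (\<lambda>G. (\<Sum>j<n. H G j * x G j) + (1 - \<alpha> i) * x0 $ i)"
    proof (rule E_cong)
      fix G assume G: "G \<in> set_pmf (random_digraph n p)"
      show "x G i = (\<Sum>j<n. H G j * x G j) + (1 - \<alpha> i) * x0 $ i"
        unfolding H_def sum_H_mat[OF set_random_digraph[OF G] i] unfolding x_def
        using averaging.stable_opinion_fixpoint[OF avg[OF G] i] .
    qed
    also have "\<dots> = (\<Sum>j<n. E (\<lambda>G. H G j * x G j)) + (1 - \<alpha> i) * x0 $ i"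
      by (simp only: E_add E_sum) (simp add: E_def)
    finally show ?thesis .
  qed
  have summand: "\<bar>E (\<lambda>G. H G j * x G j) - M j * E (\<lambda>G. x G j)\<bar> \<le> 2 * (M j * E (\<lambda>G. h G j))"
    if j: "j < n" for j
  proof -
    have "E (\<lambda>G. H G j * x G j) = E (\<lambda>G. H G j * (x G j - z G j)) + M j * E (\<lambda>G. z G j)"
      unfolding indep[OF j, of "\<lambda>G. x G j", folded z_def, symmetric] E_add[symmetric]
      by (simp add: algebra_simps)
    moreover have "E (\<lambda>G. x G j) = E (\<lambda>G. x G j - z G j) + E (\<lambda>G. z G j)"
      unfolding E_add[symmetric] by simp
    ultimately have eq: "E (\<lambda>G. H G j * x G j) - M j * E (\<lambda>G. x G j) =
        E (\<lambda>G. H G j * (x G j - z G j)) - M j * E (\<lambda>G. x G j - z G j)"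
      by (simp add: algebra_simps)
    have "\<bar>E (\<lambda>G. H G j * (x G j - z G j))\<bar> \<le> E (\<lambda>G. \<bar>H G j * (x G j - z G j)\<bar>)"
      by (rule E_abs)
    also have "\<dots> \<le> E (\<lambda>G. H G j * h G j)"
      using d[OF _ j] i j av by (intro E_mono) (auto simp: abs_mult H_def H_mat_nonneg intro!: mult_left_mono)
    \<comment> \<open>The hitting probability also lives on the cut graph, so it factors out as
      \<open>z\<close> does.\<close>
    also have "\<dots> = M j * E (\<lambda>G. h G j)"
      using indep[OF j, of "\<lambda>G. visit n a i G j"] by (simp add: h_def)
    finally have 1: "\<bar>E (\<lambda>G. H G j * (x G j - z G j))\<bar> \<le> M j * E (\<lambda>G. h G j)" .
    have "\<bar>E (\<lambda>G. x G j - z G j)\<bar> \<le> E (\<lambda>G. \<bar>x G j - z G j\<bar>)"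
      by (rule E_abs)
    also have "\<dots> \<le> E (\<lambda>G. h G j)"
      using d[OF _ j] by (rule E_mono)
    finally have "\<bar>M j * E (\<lambda>G. x G j - z G j)\<bar> \<le> M j * E (\<lambda>G. h G j)"
      using M_nonneg[OF j] by (simp add: abs_mult mult_left_mono)
    with 1 show ?thesis unfolding eq by linarith
  qed
  have "E (\<lambda>G. h G j) \<le> K" if j: "j < n" "j \<noteq> i" for j
  proof -
    have "E (\<lambda>G. h G j) \<le> E (\<lambda>G. visit n a i G j / (1 - a))"
      unfolding h_def using i j by (intro E_mono visit_removed_row_le set_random_digraph)
    also have "\<dots> = E (\<lambda>G. visit n a i G j) / (1 - a)"
      by (simp add: E_def)
    also have "\<dots> \<le> (1 / (real n - 1)) / (1 - a)"
      unfolding E_def using i j av by (intro divide_right_mono expectation_visit_le) auto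
    finally show ?thesis by (simp add: K_def mult.commute)
  qed
  moreover have "E (\<lambda>G. h G i) \<le> 1"
  proof -
    have "E (\<lambda>G. h G i) \<le> E (\<lambda>_. 1)"
      unfolding h_def using i
      by (intro E_mono) (simp add: visit_removed_row_self[OF set_random_digraph])
    then show ?thesis by (simp add: E_def)
  qed
  \<comment> \<open>The trivial bound 1 at j = i is harmless, as it will be multiplied by the small
    diagonal entry \<open>M i\<close>.\<close>
  ultimately have h_le: "E (\<lambda>G. h G j) \<le> of_bool (j = i) + K" if "j < n" for j
    using that K by (cases "j = i") (auto simp: add_increasing2)
  have "(\<Sum>j<n. M j * E (\<lambda>G. h G j)) \<le> (\<Sum>j<n. M j * (of_bool (j = i) + K))"
    using h_le M_nonneg by (intro sum_mono mult_left_mono) auto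
  also have "\<dots> = M i + (\<Sum>j<n. M j) * K"
  proof -
    have "(\<Sum>j<n. M j * of_bool (j = i)) = (\<Sum>j<n. if j = i then M j else 0)"
      by (intro sum.cong) auto
    then show ?thesis using i by (simp add: distrib_left sum.distrib sum_distrib_right)
  qed
  \<comment> \<open>The row sum of \<open>M\<close> is \<alpha> at \<open>i\<close>, hence at most
    1.\<close>
  also have "\<dots> \<le> (1 - p) ^ (n - 1) + 1 * K"
    using K i av(1)[OF i] order_trans[OF av(2)[OF i], of 1] av(4) p unfolding M_def
    by (intro add_mono mult_right_mono expected_H_diag_le) (auto simp: expected_H_row_sum)
  finally have sum_h: "(\<Sum>j<n. M j * E (\<lambda>G. h G j)) \<le> (1 - p) ^ (n - 1) + K" by simp
  have x_E: "expected_stable_opinion n p \<alpha> x0 $ j = E (\<lambda>G. x G j)" if "j < n" for j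
    using that by (simp add: expected_stable_opinion_def E_def x_def)
  have "expected_stable_opinion n p \<alpha> x0 $ i -
      ((\<Sum>j<n. M j * expected_stable_opinion n p \<alpha> x0 $ j) + (1 - \<alpha> i) * x0 $ i) =
      (\<Sum>j<n. E (\<lambda>G. H G j * x G j) - M j * E (\<lambda>G. x G j))"
    using i by (simp add: x_E x_fix sum_subtractf)
  also have "\<bar>\<dots>\<bar> \<le> (\<Sum>j<n. 2 * (M j * E (\<lambda>G. h G j)))"
    using summand by (intro order_trans[OF sum_abs] sum_mono) auto
  also have "\<dots> \<le> 2 * ((1 - p) ^ (n - 1) + K)"
    using sum_h by (simp add: sum_distrib_left[symmetric])
  finally show ?thesis by (simp add: M_def K_def)
qed

text \<open>The error \<open>e\<close> satisfies e = M e + r, where r is the residual bounded above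
  and M contracts the sup norm by \<open>a\<close>; hence the loss of the factor 1 / (1 -
  a).\<close>

lemma expectation_bias_le:
  assumes av: "\<And>i. i < n \<Longrightarrow> 0 \<le> \<alpha> i" "\<And>i. i < n \<Longrightarrow> \<alpha> i \<le> a" "0 \<le> a" "a < 1"
    and p: "0 \<le> p" "p \<le> 1"
    and x0: "x0 \<in> carrier_vec n" "\<And>i. i < n \<Longrightarrow> 0 \<le> x0 $ i \<and> x0 $ i \<le> 1"
    and i: "i < n" and n: "2 \<le> n"
  shows "\<bar>expected_stable_opinion n p \<alpha> x0 $ i - mean_field_stable n p \<alpha> x0 $ i\<bar>
    \<le> 2 * ((1 - p) ^ (n - 1) + 1 / ((1 - a) * (real n - 1))) / (1 - a)"
proof -
  define \<delta> where "\<delta> = 2 * ((1 - p) ^ (n - 1) + 1 / ((1 - a) * (real n - 1)))"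
  \<comment> \<open>The fixed point of the map K to \<delta> + a K: from
    \<open>\<bar>e j\<bar> \<le> m + K\<close> for all j follows
    \<open>\<bar>e i\<bar> \<le> a * m + K\<close>, as the maximum principle requires.\<close>
  define K where "K = \<delta> / (1 - a)"
  define M where "M i j = expected_H n p \<alpha> $$ (i, j)" for i j
  define e where "e i = expected_stable_opinion n p \<alpha> x0 $ i - mean_field_stable n p \<alpha> x0 $ i" for i
  have "\<delta> + a * K = K" using av by (simp add: K_def field_simps)
  moreover have "0 \<le> K" using av p n by (simp add: K_def \<delta>_def)
  ultimately have K: "\<delta> + a * K = K" "0 \<le> K" .
  have "\<bar>e i\<bar> - K \<le> 0"
    using av(4) _ i
  proof (rule maximum_principle)
    fix i m assume i: "i < n" and m: "(0::real) \<le> m" "\<And>j. j < n \<Longrightarrow> \<bar>e j\<bar> - K \<le> m"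
    have M: "0 \<le> M i j" if "j < n" for j
      unfolding M_def using i that av by (intro expected_H_nonneg) auto
    have "\<bar>e i - (\<Sum>j<n. M i j * e j)\<bar> \<le> \<delta>"
    proof -
      have "\<bar>expected_stable_opinion n p \<alpha> x0 $ i -
          ((\<Sum>j<n. M i j * expected_stable_opinion n p \<alpha> x0 $ j) + (1 - \<alpha> i) * x0 $ i)\<bar> \<le> \<delta>"
        unfolding M_def \<delta>_def using av p x0(2) i n by (rule expectation_fixpoint_residual)
      moreover have "mean_field_stable n p \<alpha> x0 $ i =
          (\<Sum>j<n. M i j * mean_field_stable n p \<alpha> x0 $ j) + (1 - \<alpha> i) * x0 $ i"
        unfolding M_def using x0(1) av i by (rule mean_field_stable_fixpoint)
      moreover have "(\<Sum>j<n. M i j * e j) =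
          (\<Sum>j<n. M i j * expected_stable_opinion n p \<alpha> x0 $ j) -
          (\<Sum>j<n. M i j * mean_field_stable n p \<alpha> x0 $ j)"
        by (simp add: e_def right_diff_distrib sum_subtractf)
      ultimately show ?thesis unfolding e_def[of i] by linarith
    qed
    then have "\<bar>e i\<bar> \<le> \<bar>\<Sum>j<n. M i j * e j\<bar> + \<delta>" by linarith
    also have "\<bar>\<Sum>j<n. M i j * e j\<bar> \<le> (\<Sum>j<n. M i j * (m + K))"
    proof (intro order_trans[OF sum_abs] sum_mono)
      fix j assume "j \<in> {..<n}"
      with m(2)[of j] M[of j] show "\<bar>M i j * e j\<bar> \<le> M i j * (m + K)"
        by (simp add: abs_mult mult_left_mono)
    qed
    also have "\<dots> \<le> a * (m + K)"
      unfolding sum_distrib_right[symmetric] M_def expected_H_row_sum[OF i]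
      using av(2)[OF i] m K by (intro mult_right_mono) auto
    finally show "\<bar>e i\<bar> - K \<le> a * m" using K by (simp add: algebra_simps)
  qed
  then show ?thesis by (simp add: e_def K_def \<delta>_def)
qed

subsection \<open>Asymptotics\<close>

lemma lp_norm_le:
  assumes \<rho>: "0 < \<rho>" and K: "0 \<le> K" and v: "\<And>i. i < dim_vec v \<Longrightarrow> \<bar>v $ i\<bar> \<le> K"
  shows "lp_norm \<rho> v \<le> real (dim_vec v) powr (1 / \<rho>) * K"
proof -
  have "(\<Sum>i<dim_vec v. \<bar>v $ i\<bar> powr \<rho>) \<le> (\<Sum>i<dim_vec v. K powr \<rho>)"
    using v \<rho> by (intro sum_mono powr_mono2) auto
  then have "lp_norm \<rho> v \<le> (real (dim_vec v) * K powr \<rho>) powr (1 / \<rho>)"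
    unfolding lp_norm_def using \<rho> by (intro powr_mono2) (auto intro: sum_nonneg)
  also have "\<dots> = real (dim_vec v) powr (1 / \<rho>) * K"
    using \<rho> K by (simp add: powr_mult powr_powr)
  finally show ?thesis .
qed

text \<open>From 1 - p \<le> exp(-p) the left side is at most exp(-p (n - 1)), and the growth of
  \<open>p\<close> eventually makes p (n - 1) at least ln n.\<close>

lemma eventually_no_edge_prob_le:
  assumes p: "\<And>n. n \<ge> 1 \<Longrightarrow> 0 < p n \<and> p n < 1"
    and large: "p \<ggreater> (\<lambda>n. (ln (real n))\<^sup>2 / real n)"
  shows "eventually (\<lambda>n. (1 - p n) ^ (n - 1) \<le> 1 / real n) sequentially"
proof -
  \<comment> \<open>The ratio exceeds every constant; 2 is chosen to absorb n \<le> 2 (n - 1)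
    below.\<close>
  have "eventually (\<lambda>n. 2 \<le> p n / ((ln (real n))\<^sup>2 / real n)) sequentially"
    using large unfolding asymp_dominates_def filterlim_at_top by blast
  moreover have "eventually (\<lambda>n. 1 \<le> ln (real n)) sequentially"
    by real_asymp
  moreover have "eventually (\<lambda>n. n \<ge> 2) sequentially"
    by (rule eventually_ge_at_top)
  ultimately show ?thesis
  proof eventually_elim
    case (elim n)
    define L where "L = ln (real n)"
    have L: "1 \<le> L" and n: "2 \<le> n" using elim by (simp_all add: L_def)
    have "2 * L\<^sup>2 \<le> p n * real n"
      using elim(1) L n by (simp add: L_def[symmetric] field_simps)
    also have "\<dots> \<le> p n * (2 * real (n - 1))"
      using n p[of n] by (intro mult_left_mono) (auto simp: of_nat_diff)
    finally have "L\<^sup>2 \<le> p n * real (n - 1)" by simp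
    moreover have "L \<le> L\<^sup>2" using L by (simp add: power2_eq_square)
    ultimately have L_le: "L \<le> p n * real (n - 1)" by simp
    have "(1 - p n) ^ (n - 1) \<le> exp (- p n) ^ (n - 1)"
      using p[of n] n exp_ge_add_one_self[of "- p n"] by (intro power_mono) auto
    also have "\<dots> = exp (- (p n * real (n - 1)))"
      by (simp add: exp_of_nat_mult[symmetric] mult.commute)
    also have "\<dots> \<le> exp (- L)" using L_le by simp
    also have "\<dots> = 1 / real n" using n by (simp add: L_def exp_minus field_simps)
    finally show ?case .
  qed
qed

theorem theorem5p5:
  fixes p :: "nat \<Rightarrow> real"
    and \<alpha> :: "nat \<Rightarrow> nat \<Rightarrow> real"
    and x0 :: "nat \<Rightarrow> real vec"
    and \<alpha>bar \<rho> :: real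
  assumes p_range: "\<And>n. n \<ge> 1 \<Longrightarrow> 0 < p n \<and> p n < 1"
    and p_large: "p \<ggreater> (\<lambda>n. (ln (real n))\<^sup>2 / real n)"
    and x0_dim: "\<And>n. n \<ge> 1 \<Longrightarrow> x0 n \<in> carrier_vec n"
    and x0_range: "\<And>n i. n \<ge> 1 \<Longrightarrow> i < n \<Longrightarrow> 0 \<le> x0 n $ i \<and> x0 n $ i \<le> 1"
    and \<alpha>_range: "\<And>n i. n \<ge> 1 \<Longrightarrow> i < n \<Longrightarrow> 0 \<le> \<alpha> n i \<and> \<alpha> n i \<le> 1"
    and \<alpha>bar_range: "0 < \<alpha>bar" "\<alpha>bar < 1"
    and \<alpha>_bound: "\<And>n i. n \<ge> 1 \<Longrightarrow> i < n \<Longrightarrow> \<alpha> n i \<le> \<alpha>bar"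
    and \<rho>: "1 < \<rho>"
  shows "(\<lambda>n. lp_norm \<rho> (expected_stable_opinion n (p n) (\<alpha> n) (x0 n)
                         - mean_field_stable n (p n) (\<alpha> n) (x0 n)))
         \<longlonglongrightarrow> 0"
proof (rule Lim_null_comparison)
  \<comment> \<open>Obtained from \<open>expectation_bias_le\<close> by inserting (1 - p)^(n-1)
    \<le> 1/n and 1/(n-1) \<le> 2/n, so that every entry of the bias is at most C/n.\<close>
  define C where "C = 2 * (1 + 2 / (1 - \<alpha>bar)) / (1 - \<alpha>bar)"
  have C: "0 \<le> C" using \<alpha>bar_range by (simp add: C_def)
  \<comment> \<open>Here \<rho> > 1 is decisive: n entries of size C/n have \<rho>-norm at most C
    n^(1/\<rho> - 1), with a negative exponent.\<close>
  have "((\<lambda>x. x powr (1 / \<rho> - 1)) \<longlongrightarrow> 0) (at_top :: real filter)"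
    using \<rho> by (intro tendsto_neg_powr filterlim_ident) auto
  from filterlim_compose[OF this filterlim_real_sequentially]
  have "(\<lambda>n. real n powr (1 / \<rho> - 1)) \<longlonglongrightarrow> 0" .
  then show "(\<lambda>n. C * real n powr (1 / \<rho> - 1)) \<longlonglongrightarrow> 0"
    by (rule tendsto_mult_right_zero)
  have no_edge: "eventually (\<lambda>n. (1 - p n) ^ (n - 1) \<le> 1 / real n) sequentially"
    using p_range p_large by (rule eventually_no_edge_prob_le)
  show "eventually (\<lambda>n. norm (lp_norm \<rho> (expected_stable_opinion n (p n) (\<alpha> n) (x0 n)
      - mean_field_stable n (p n) (\<alpha> n) (x0 n))) \<le> C * real n powr (1 / \<rho> - 1)) sequentially"
    using no_edge eventually_ge_at_top[of 2]
  proof eventually_elim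
    case (elim n)
    let ?v = "expected_stable_opinion n (p n) (\<alpha> n) (x0 n) - mean_field_stable n (p n) (\<alpha> n) (x0 n)"
    have n: "1 \<le> n" using elim by simp
    have dim: "dim_vec ?v = n" by (simp add: mean_field_stable_def)
    have "1 / ((1 - \<alpha>bar) * (real n - 1)) \<le> 2 / (1 - \<alpha>bar) * (1 / real n)"
    proof -
      have "1 / (1 - \<alpha>bar) * (1 / (real n - 1)) \<le> 1 / (1 - \<alpha>bar) * (2 / real n)"
        using elim(2) \<alpha>bar_range by (intro mult_left_mono) (auto simp: field_simps)
      then show ?thesis by simp
    qed
    then have "(1 - p n) ^ (n - 1) + 1 / ((1 - \<alpha>bar) * (real n - 1)) \<le> (1 + 2 / (1 - \<alpha>bar)) * (1 / real n)"
      using elim(1) unfolding distrib_right by linarith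
    then have "2 * ((1 - p n) ^ (n - 1) + 1 / ((1 - \<alpha>bar) * (real n - 1))) / (1 - \<alpha>bar)
        \<le> 2 * ((1 + 2 / (1 - \<alpha>bar)) * (1 / real n)) / (1 - \<alpha>bar)"
      using \<alpha>bar_range by (intro divide_right_mono mult_left_mono) auto
    also have "\<dots> = C / real n" by (simp add: C_def)
    finally have bound: "2 * ((1 - p n) ^ (n - 1) + 1 / ((1 - \<alpha>bar) * (real n - 1))) / (1 - \<alpha>bar)
        \<le> C / real n" .
    have "\<bar>?v $ i\<bar> \<le> C / real n" if i: "i < n" for i
    proof -
      have "\<bar>?v $ i\<bar> = \<bar>expected_stable_opinion n (p n) (\<alpha> n) (x0 n) $ i
          - mean_field_stable n (p n) (\<alpha> n) (x0 n) $ i\<bar>"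
        using i by (simp add: mean_field_stable_def)
      also have "\<dots> \<le> 2 * ((1 - p n) ^ (n - 1) + 1 / ((1 - \<alpha>bar) * (real n - 1))) / (1 - \<alpha>bar)"
        using \<alpha>_range[OF n] \<alpha>_bound[OF n] \<alpha>bar_range p_range[OF n] x0_dim[OF n] x0_range[OF n] i elim(2)
        by (intro expectation_bias_le) auto
      finally show ?thesis using bound by simp
    qed
    then have "lp_norm \<rho> ?v \<le> real n powr (1 / \<rho>) * (C / real n)"
      using lp_norm_le[of \<rho> "C / real n" ?v] \<rho> C by (simp only: dim) simp
    also have "\<dots> = C * real n powr (1 / \<rho> - 1)"
      using n by (simp add: powr_diff)
    finally show ?case by (simp add: lp_norm_def)
  qed
qed

end
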